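(* Let $G$ and $H$ be graphs with $\chi(G)<\chi(H)$. Then there exists a graph $F$ such that $F\rightarrow G$ and $F\not\rightarrow H$.
   Context: Graphs are finite and simple. $\chi(G)$ denotes the chromatic number of $G$, i.e. the minimum number of colours in a vertex colouring of $G$ in which no two adjacent vertices receive the same colour. For graphs $F$ and $G$, $F\rightarrow G$ ("$F$ is Ramsey for $G$") means that every colouring of the edges of $F$ in two colours contains a monochromatic copy of $G$, that is, a (not necessarily induced) subgraph of $F$ isomorphic to $G$ all of whose edges have the same colour. $F\not\rightarrow G$ means that $F$ is not Ramsey for $G$. *)

theory Defs
  imports "HOL-Library.Ramsey"
begin

record 'a ugraph =
  verts :: "'a set"
  edges :: "'a set set"

text \<open>Edges are unordered pairs of distinct vertices; the graph without vertices is allowed.\<close>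

definition simple_graph :: "'a ugraph \<Rightarrow> bool" where
  "simple_graph G \<longleftrightarrow> finite (verts G) \<and> edges G \<subseteq> nsets (verts G) 2"

definition proper_colouring :: "'a ugraph \<Rightarrow> nat \<Rightarrow> ('a \<Rightarrow> nat) \<Rightarrow> bool" where
  "proper_colouring G k c \<longleftrightarrow>
     c ` verts G \<subseteq> {..<k} \<and> (\<forall>u v. {u, v} \<in> edges G \<longrightarrow> c u \<noteq> c v)"

definition chromatic_number :: "'a ugraph \<Rightarrow> nat" where
  "chromatic_number G = (LEAST k. \<exists>c. proper_colouring G k c)"

definition subgraph :: "'a ugraph \<Rightarrow> 'a ugraph \<Rightarrow> bool" where
  "subgraph S F \<longleftrightarrow> simple_graph S \<and> verts S \<subseteq> verts F \<and> edges S \<subseteq> edges F"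

definition graph_iso :: "'a ugraph \<Rightarrow> 'b ugraph \<Rightarrow> bool" where
  "graph_iso G H \<longleftrightarrow>
     (\<exists>f. bij_betw f (verts G) (verts H) \<and>
          (\<forall>u\<in>verts G. \<forall>v\<in>verts G. {u, v} \<in> edges G \<longleftrightarrow> {f u, f v} \<in> edges H))"

text \<open>
  The two colours are the elements of \<^typ>\<open>bool\<close>. A colouring is a total function on vertex sets,
  of which only the values on \<^term>\<open>edges F\<close> are used.
\<close>

definition is_ramsey_for :: "'a ugraph \<Rightarrow> 'b ugraph \<Rightarrow> bool" where
  "is_ramsey_for F G \<longleftrightarrow>
     (\<forall>c :: 'a set \<Rightarrow> bool. \<exists>S. subgraph S F \<and> graph_iso S G \<and>
        (\<exists>b. \<forall>e\<in>edges S. c e = b))"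

text \<open>For finite graphs the minimum in \<^const>\<open>chromatic_number\<close> is attained.\<close>

lemma ex_proper_colouring:
  assumes "simple_graph G"
  shows "\<exists>k c. proper_colouring G k c"
proof -
  have "finite (verts G)" using assms by (simp add: simple_graph_def)
  then obtain c :: "'a \<Rightarrow> nat" and n where c: "c ` verts G = {i. i < n}" "inj_on c (verts G)"
    using finite_imp_inj_to_nat_seg by metis
  have "c u \<noteq> c v" if "{u, v} \<in> edges G" for u v
  proof -
    have "{u, v} \<in> nsets (verts G) 2" using assms that unfolding simple_graph_def by blast
    then have "u \<in> verts G" "v \<in> verts G" "u \<noteq> v"
      by (auto simp: nsets_def card_insert_if split: if_splits)
    then show ?thesis using c(2) by (auto dest: inj_onD)
  qed
  then have "proper_colouring G n c" using c(1) by (auto simp: proper_colouring_def)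
  then show ?thesis by blast
qed

lemma chromatic_number_attained:
  assumes "simple_graph G"
  shows "\<exists>c. proper_colouring G (chromatic_number G) c"
  using ex_proper_colouring[OF assms] unfolding chromatic_number_def by (rule LeastI_ex)

end

theory Submission
  imports Defs "HOL-Library.Countable" "HOL-Combinatorics.Transposition"
begin

text \<open>
  For every \<open>G\<close> and every \<open>s\<close> there is a graph \<open>F\<close> that is Ramsey for \<open>G\<close> while each set of at most
  \<open>s\<close> vertices of \<open>F\<close> is \<open>\<chi>(G)\<close>-colourable; for \<open>s\<close> the order of \<open>H\<close>, such an \<open>F\<close> does not contain
  \<open>H\<close> at all. The proof is by induction on \<open>s\<close>, starting from Ramsey's theorem. Given \<open>F\<close> for \<open>s\<close>, the
  partite construction of Nesetril and Rodl over \<open>F\<close> starts from a disjoint union of copies of \<open>G\<close>, one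
  for each copy in \<open>F\<close>, and amalgamates once for each edge of \<open>F\<close>. The result maps homomorphically
  to \<open>F\<close>, so a set of \<open>s + 1\<close> vertices is \<open>\<chi>(G)\<close>-colourable by induction unless the homomorphism is
  injective on it. Such a transversal set stays colourable in every amalgamation along a level pair
  \<open>{i, j}\<close>: it has at most one vertex in level \<open>i\<close> and one in level \<open>j\<close>, and two Hales-Jewett copies can
  share two such vertices only if these are adjacent in both, so the colourings of its traces on
  the copies agree there after permuting colours.
\<close>

section \<open>The Hales-Jewett theorem for two colours\<close>

definition subst_word :: "'a \<Rightarrow> 'a option list \<Rightarrow> 'a list" where
  "subst_word a w = map (case_option a id) w"

text \<open>\<open>None\<close> is the variable, so a variable word is a combinatorial line whose
  points are the words \<open>subst_word a w\<close>.\<close>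

definition variable_words :: "'a set \<Rightarrow> 'a option list set" where
  "variable_words A = {w. None \<in> set w \<and> set w \<subseteq> insert None (Some ` A)}"

text \<open>Each block of \<open>W\<close> has its own variable and \<open>x\<close> lists the
  values of these variables, so the words \<open>fill W x\<close> form a combinatorial subspace of
  dimension \<open>length W\<close>.\<close>

definition fill :: "'a option list list \<Rightarrow> 'a list \<Rightarrow> 'a list" where
  "fill W x = concat (map2 (\<lambda>w s. subst_word s w) W x)"

lemma length_subst_word [simp]: "length (subst_word a w) = length w"
  by (simp add: subst_word_def)

lemma set_subst_word: "w \<in> variable_words A \<Longrightarrow> a \<in> A \<Longrightarrow> set (subst_word a w) \<subseteq> A"
  by (auto simp: variable_words_def subst_word_def split: option.splits)

lemma fill_Cons: "fill (w # W) (s # x) = subst_word s w @ fill W x"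
  by (simp add: fill_def)

text \<open>
  Shelah's pigeonhole argument. The set \<open>P\<close> of prefixes makes the induction on the number of blocks
  work: the length \<open>N\<close> of the first block depends on \<open>P\<close> only, and the remaining blocks are chosen to be
  insensitive behind all words of length \<open>N\<close>.
\<close>

lemma swap_insensitive_blocks:
  fixes A :: "'a set"
  assumes A: "finite A" "a \<in> A" "b \<in> A" and "finite P"
  shows "\<exists>n. \<forall>f :: 'a list \<Rightarrow> bool. \<exists>W. length W = k \<and> length (concat W) = n \<and>
     set W \<subseteq> variable_words A \<and>
     (\<forall>p\<in>P. \<forall>x y. set x \<subseteq> A \<longrightarrow> set y \<subseteq> A \<longrightarrow> length x = k \<longrightarrow>
        list_all2 (\<lambda>s t. s = t \<or> {s, t} = {a, b}) x y \<longrightarrow> f (p @ fill W x) = f (p @ fill W y))"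
  using \<open>finite P\<close>
proof (induction k arbitrary: P)
  case 0
  show ?case by (intro exI[of _ 0] allI exI[of _ "[]"]) auto
next
  case (Suc k)
  define X where "X = {x. set x \<subseteq> A \<and> length x = k}"
  have X: "finite X" using A(1) unfolding X_def by (rule finite_lists_length_eq)
  \<comment> \<open>Pigeonhole bound: \<open>N\<close> counts the possible values of
    \<open>C\<close> below, while \<open>m\<close> ranges over the \<open>N + 1\<close> numbers up
    to \<open>N\<close>.\<close>
  define N where "N = card (Pow (P \<times> X))"
  define U where "U = {u. set u \<subseteq> A \<and> length u = N}"
  have "finite U" using A(1) unfolding U_def by (rule finite_lists_length_eq)
  then have "finite ((\<lambda>(p, u). p @ u) ` (P \<times> U))" using Suc.prems by simp
  from Suc.IH[OF this] obtain n where n: "\<And>f :: 'a list \<Rightarrow> bool. \<exists>W. length W = k \<and>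
     length (concat W) = n \<and> set W \<subseteq> variable_words A \<and>
     (\<forall>p\<in>(\<lambda>(p, u). p @ u) ` (P \<times> U). \<forall>x y. set x \<subseteq> A \<longrightarrow> set y \<subseteq> A \<longrightarrow> length x = k \<longrightarrow>
        list_all2 (\<lambda>s t. s = t \<or> {s, t} = {a, b}) x y \<longrightarrow> f (p @ fill W x) = f (p @ fill W y))"
    by auto
  show ?case
  proof (intro exI[of _ "N + n"] allI)
    fix f :: "'a list \<Rightarrow> bool"
    obtain W where W: "length W = k" "length (concat W) = n" "set W \<subseteq> variable_words A"
      and ins: "\<And>p u x y. p \<in> P \<Longrightarrow> u \<in> U \<Longrightarrow> set x \<subseteq> A \<Longrightarrow> set y \<subseteq> A \<Longrightarrow> length x = k \<Longrightarrow>
        list_all2 (\<lambda>s t. s = t \<or> {s, t} = {a, b}) x y \<Longrightarrow>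
        f (p @ u @ fill W x) = f (p @ u @ fill W y)"
      using n[of f] by fastforce
    define u where "u m = replicate m b @ replicate (N - m) a" for m
    define C where "C m = {(p, x) \<in> P \<times> X. f (p @ u m @ fill W x)}" for m
    have "C ` {..N} \<subseteq> Pow (P \<times> X)" by (auto simp: C_def)
    then have "card (C ` {..N}) \<le> N"
      unfolding N_def using Suc.prems X by (intro card_mono) auto
    then have "\<not> inj_on C {..N}" using card_image[of C "{..N}"] by auto
    then obtain m1 m2 where m: "m1 < m2" "m2 \<le> N" "C m1 = C m2"
      unfolding inj_on_def by (metis atMost_iff linorder_neqE_nat)
    \<comment> \<open>The variable occupies exactly the positions in which \<open>u m1\<close> and
      \<open>u m2\<close> differ, so the letters \<open>a\<close> and \<open>b\<close> produce these
      two words. As \<open>C m1 = C m2\<close>, exchanging \<open>a\<close> and \<open>b\<close> in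
      the first block does not change the colour.\<close>
    define w where
      "w = replicate m1 (Some b) @ replicate (m2 - m1) None @ replicate (N - m2) (Some a)"
    have wa: "subst_word a w = u m1"
      using m by (simp add: w_def u_def subst_word_def flip: replicate_add)
    have wb: "subst_word b w = u m2"
      using m by (simp add: w_def u_def subst_word_def flip: replicate_add append_assoc)
    have w: "w \<in> variable_words A" "length w = N"
      using m A by (auto simp: variable_words_def w_def)
    have ab: "f (p @ subst_word a w @ fill W x) = f (p @ subst_word b w @ fill W x)"
      if "p \<in> P" "x \<in> X" for p x
      using m(3) that unfolding wa wb by (auto simp: C_def set_eq_iff)
    have main: "f (p @ fill (w # W) x) = f (p @ fill (w # W) y)"
      if p: "p \<in> P" and xy: "set x \<subseteq> A" "set y \<subseteq> A" "length x = Suc k"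
        "list_all2 (\<lambda>s t. s = t \<or> {s, t} = {a, b}) x y" for p x y
    proof -
      obtain s x' where x: "x = s # x'" using xy(3) by (cases x) auto
      then obtain t y' where y: "y = t # y'" using xy(4) by (cases y) auto
      have len: "length y' = k" using xy x y list_all2_lengthD by fastforce
      \<comment> \<open>Two moves: the later blocks change first, behind the prefix
        \<open>p @ subst_word s w\<close>; then the first block changes alone, in front of the fixed
        filling by \<open>y'\<close>.\<close>
      have "subst_word s w \<in> U"
        using set_subst_word[OF w(1)] xy(1) w(2) x unfolding U_def by auto
      then have "f (p @ subst_word s w @ fill W x') = f (p @ subst_word s w @ fill W y')"
        using p xy x y by (intro ins) auto
      also have "\<dots> = f (p @ subst_word t w @ fill W y')"
      proof -
        have "s = t \<or> {s, t} = {a, b}" using xy(4) x y by simp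
        moreover have "y' \<in> X" using xy(2) y len by (auto simp: X_def)
        ultimately show ?thesis using ab[OF p] by (auto simp: doubleton_eq_iff)
      qed
      finally show ?thesis by (simp add: x y fill_Cons)
    qed
    show "\<exists>W. length W = Suc k \<and> length (concat W) = N + n \<and> set W \<subseteq> variable_words A \<and>
     (\<forall>p\<in>P. \<forall>x y. set x \<subseteq> A \<longrightarrow> set y \<subseteq> A \<longrightarrow> length x = Suc k \<longrightarrow>
        list_all2 (\<lambda>s t. s = t \<or> {s, t} = {a, b}) x y \<longrightarrow> f (p @ fill W x) = f (p @ fill W y))"
      using main w W by (intro exI[of _ "w # W"]) auto
  qed
qed

text \<open>The image of the line \<open>v\<close> under \<open>fill W\<close>, again as a variable
  word. Blocks at occurrences of the variable in \<open>v\<close> stay open, and their variables are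
  merged into one.\<close>

definition compose_words :: "'a option list list \<Rightarrow> 'a option list \<Rightarrow> 'a option list" where
  "compose_words W v = concat (map2 (\<lambda>w s. case s of None \<Rightarrow> w | Some t \<Rightarrow> map Some (subst_word t w)) W v)"

lemma subst_compose_words:
  "length W = length v \<Longrightarrow> subst_word c (compose_words W v) = fill W (subst_word c v)"
  by (induction W v rule: list_induct2)
    (auto simp: compose_words_def fill_def subst_word_def split: option.splits)

lemma length_compose_words:
  "length W = length v \<Longrightarrow> length (compose_words W v) = length (concat W)"
  by (induction W v rule: list_induct2) (auto simp: compose_words_def split: option.splits)

lemma set_compose_words:
  assumes "length W = length v" "set W \<subseteq> variable_words A" "set v \<subseteq> insert None (Some ` A)"
  shows "set (compose_words W v) \<subseteq> insert None (Some ` A)"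
  using assms
proof (induction W v rule: list_induct2)
  case (Cons w W s v)
  have "set (case s of None \<Rightarrow> w | Some t \<Rightarrow> map Some (subst_word t w)) \<subseteq> insert None (Some ` A)"
    using Cons.prems set_subst_word[of w A] by (cases s) (auto simp: variable_words_def)
  with Cons show ?case by (simp add: compose_words_def)
qed (auto simp: compose_words_def)

lemma None_compose_words:
  assumes "length W = length v" "set W \<subseteq> variable_words A" "None \<in> set v"
  shows "None \<in> set (compose_words W v)"
  using assms
  by (induction W v rule: list_induct2) (auto simp: compose_words_def variable_words_def)

text \<open>Induction on the alphabet. For a new letter \<open>b\<close>, choose blocks insensitive
  to exchanging \<open>b\<close> with an old letter \<open>a\<close>, and a line over the old
  alphabet that is monochromatic for the colouring read through the blocks. Its point at
  \<open>b\<close> arises from its point at \<open>a\<close> by such exchanges, so it has the same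
  colour.\<close>

theorem Hales_Jewett:
  fixes A :: "'a set"
  assumes "finite A"
  shows "\<exists>n. \<forall>f :: 'a list \<Rightarrow> bool. \<exists>w\<in>variable_words A. length w = n \<and>
    (\<exists>b. \<forall>a\<in>A. f (subst_word a w) = b)"
  using assms
proof (induction A)
  case empty
  show ?case by (intro exI[of _ 1] allI bexI[of _ "[None]"]) (auto simp: variable_words_def)
next
  case (insert b A)
  show ?case
  \<comment> \<open>With \<open>b\<close> as the only letter there is no old letter to exchange it
    with, but every line is then a single point.\<close>
  proof (cases "A = {}")
    case True
    then show ?thesis
      by (intro exI[of _ 1] allI bexI[of _ "[None]"]) (auto simp: variable_words_def)
  next
    case False
    then obtain a where a: "a \<in> A" by blast
    let ?B = "insert b A"
    obtain k where k: "\<And>f :: 'a list \<Rightarrow> bool. \<exists>w\<in>variable_words A. length w = k \<and>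
        (\<exists>b. \<forall>a\<in>A. f (subst_word a w) = b)"
      using insert.IH by blast
    from insert.hyps a have "finite ?B" "a \<in> ?B" "b \<in> ?B" by auto
    note blocks = swap_insensitive_blocks[OF this, of "{[]}" k]
    obtain n where n: "\<forall>f :: 'a list \<Rightarrow> bool. \<exists>W. length W = k \<and> length (concat W) = n \<and>
     set W \<subseteq> variable_words ?B \<and>
     (\<forall>p\<in>{[]}. \<forall>x y. set x \<subseteq> ?B \<longrightarrow> set y \<subseteq> ?B \<longrightarrow> length x = k \<longrightarrow>
        list_all2 (\<lambda>s t. s = t \<or> {s, t} = {a, b}) x y \<longrightarrow> f (p @ fill W x) = f (p @ fill W y))"
      using blocks by (rule exE) simp_all
    show ?thesis
    proof (intro exI[of _ n] allI)
      fix f :: "'a list \<Rightarrow> bool"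
      obtain W where W: "length W = k" "length (concat W) = n" "set W \<subseteq> variable_words ?B"
        and ins: "\<And>x y. set x \<subseteq> ?B \<Longrightarrow> set y \<subseteq> ?B \<Longrightarrow> length x = k \<Longrightarrow>
        list_all2 (\<lambda>s t. s = t \<or> {s, t} = {a, b}) x y \<Longrightarrow> f (fill W x) = f (fill W y)"
        using n[rule_format, of f] by auto
      obtain v c where v: "v \<in> variable_words A" "length v = k"
        and c: "\<And>a. a \<in> A \<Longrightarrow> f (fill W (subst_word a v)) = c"
        using k[of "\<lambda>x. f (fill W x)"] by blast
      have vB: "v \<in> variable_words ?B" using v(1) by (auto simp: variable_words_def)
      have "f (fill W (subst_word a v)) = f (fill W (subst_word b v))"
      proof (rule ins)
        show "list_all2 (\<lambda>s t. s = t \<or> {s, t} = {a, b}) (subst_word a v) (subst_word b v)"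
          by (auto simp: subst_word_def list_all2_conv_all_nth split: option.splits)
      qed (use set_subst_word[OF vB] a v(2) in auto)
      then have "f (fill W (subst_word a' v)) = c" if "a' \<in> ?B" for a'
        using c a that by auto
      moreover have "compose_words W v \<in> variable_words ?B"
        using W v vB set_compose_words[of W v ?B] None_compose_words[of W v ?B]
        by (auto simp: variable_words_def)
      ultimately show "\<exists>w\<in>variable_words ?B. length w = n \<and>
          (\<exists>c. \<forall>a\<in>?B. f (subst_word a w) = c)"
        using W v by (intro bexI[of _ "compose_words W v"])
          (auto simp: subst_compose_words length_compose_words)
    qed
  qed
qed

section \<open>Amalgamation along a pair of levels\<close>

lemma simple_graph_edgeE:
  assumes "simple_graph G" "e \<in> edges G"
  obtains u v where "e = {u, v}" "u \<noteq> v" "u \<in> verts G" "v \<in> verts G"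
proof -
  have "e \<in> nsets (verts G) 2" using assms by (auto simp: simple_graph_def)
  then show ?thesis using that by (auto simp: nsets_def card_2_iff)
qed

lemma simple_graph_doubletonD:
  assumes "simple_graph G" "{u, v} \<in> edges G"
  shows "u \<in> verts G" "v \<in> verts G" "u \<noteq> v"
  using assms by (auto elim!: simple_graph_edgeE simp: doubleton_eq_iff)

lemma simple_graph_edge_subset: "simple_graph G \<Longrightarrow> e \<in> edges G \<Longrightarrow> e \<subseteq> verts G"
  by (elim simple_graph_edgeE) auto

lemma simple_graph_finite_edges: "simple_graph G \<Longrightarrow> finite (edges G)"
  by (meson finite_imp_finite_nsets finite_subset simple_graph_def)

definition colourable_on :: "'a ugraph \<Rightarrow> nat \<Rightarrow> 'a set \<Rightarrow> bool" where
  "colourable_on G r X \<longleftrightarrow>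
     (\<exists>c. c ` X \<subseteq> {..<r} \<and> (\<forall>u\<in>X. \<forall>v\<in>X. {u, v} \<in> edges G \<longrightarrow> c u \<noteq> c v))"

definition embedding :: "('a \<Rightarrow> 'b) \<Rightarrow> 'a ugraph \<Rightarrow> 'b ugraph \<Rightarrow> bool" where
  "embedding q G F \<longleftrightarrow>
     inj_on q (verts G) \<and> q ` verts G \<subseteq> verts F \<and> (\<forall>e\<in>edges G. q ` e \<in> edges F)"

text \<open>
  Vertices of a partite graph are pairs of a level and a natural number. A variable word \<open>w\<close> over the
  edges between levels \<open>i\<close> and \<open>j\<close> places a copy in which the vertices of these two levels become words
  (a fixed letter contributes its endpoint in the level), and all other vertices are private to \<open>w\<close>.
\<close>

definition copy_map ::
  "'l \<Rightarrow> 'l \<Rightarrow> (nat \<times> nat) option list \<Rightarrow> 'l \<times> nat \<Rightarrow> 'l \<times> nat" where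
  "copy_map i j w x = (fst x, to_nat
     (if fst x = i then Inl (map (case_option (snd x) fst) w)
      else if fst x = j then Inl (map (case_option (snd x) snd) w)
      else Inr (w, snd x) :: nat list + (nat \<times> nat) option list \<times> nat))"

definition amalgam ::
  "'l \<Rightarrow> 'l \<Rightarrow> (nat \<times> nat) option list set \<Rightarrow> ('l \<times> nat) ugraph \<Rightarrow> ('l \<times> nat) ugraph" where
  "amalgam i j W P = \<lparr>verts = (\<Union>w\<in>W. copy_map i j w ` verts P),
                     edges = (\<Union>w\<in>W. (`) (copy_map i j w) ` edges P)\<rparr>"

definition level_pairs :: "'l \<Rightarrow> 'l \<Rightarrow> ('l \<times> nat) ugraph \<Rightarrow> (nat \<times> nat) set" where
  "level_pairs i j P = {(u, v). {(i, u), (j, v)} \<in> edges P}"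

lemma fst_copy_map [simp]: "fst (copy_map i j w x) = fst x"
  by (simp add: copy_map_def)

text \<open>At an occurrence of the variable, the code of a vertex in level \<open>i\<close> or
  \<open>j\<close> records its number \<open>snd x\<close>, which can therefore be
  recovered.\<close>

lemma inj_copy_map:
  assumes "None \<in> set w"
  shows "inj (copy_map i j w)"
proof (rule injI)
  fix x y assume eq: "copy_map i j w x = copy_map i j w y"
  then have "fst x = fst y" by (metis fst_copy_map)
  moreover have "snd x = snd y"
    using eq \<open>fst x = fst y\<close> assms
    by (auto simp: copy_map_def split: if_splits dest!: bspec[of _ _ None])
  ultimately show "x = y" by (rule prod_eqI)
qed

lemma copy_map_eq_outside:
  assumes "copy_map i j w x = copy_map i j w' x'" "fst x \<noteq> i" "fst x \<noteq> j"
  shows "w = w' \<and> x = x'"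
proof -
  have "fst x' = fst x" using assms(1) by (metis fst_copy_map)
  then show ?thesis using assms by (auto simp: copy_map_def prod_eq_iff)
qed

text \<open>At a variable position of \<open>w\<close>, a letter of \<open>w'\<close> must have the
  endpoints \<open>u\<close> and \<open>v\<close>. If \<open>w'\<close> has the variable there too,
  then \<open>u = u'\<close> and \<open>v = v'\<close>. At a position where the words differ they
  cannot both hold letters, since the endpoints would agree; so one holds the variable and the
  letter of the other is \<open>(u, v)\<close>.\<close>

lemma copies_overlap_aux:
  assumes w: "w \<in> variable_words A" "w' \<in> variable_words A" "length w = length w'" "w \<noteq> w'"
    and ij: "i \<noteq> j"
    and i: "copy_map i j w (i, u) = copy_map i j w' (i, u')"
    and j: "copy_map i j w (j, v) = copy_map i j w' (j, v')"
  shows "(u, v) \<in> A"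
proof -
  have ci: "case_option u fst (w ! c) = case_option u' fst (w' ! c)" if "c < length w" for c
    using i that w(3) by (auto simp: copy_map_def list_eq_iff_nth_eq)
  have cj: "case_option v snd (w ! c) = case_option v' snd (w' ! c)" if "c < length w" for c
    using j ij that w(3) by (auto simp: copy_map_def list_eq_iff_nth_eq)
  have A: "e \<in> A" if "w ! c = Some e \<or> w' ! c = Some e" "c < length w" for c e
  proof -
    have "Some e \<in> set w \<or> Some e \<in> set w'" using that w(3) by (metis nth_mem)
    then show ?thesis using w(1,2) by (auto simp: variable_words_def)
  qed
  have new: "(u, v) \<in> A" if "c < length w" "w ! c = None" "w' ! c = Some e" for c e
    using ci[of c] cj[of c] A[of c e] that by auto
  obtain c where c: "c < length w" "w ! c = None"
    using w(1) by (auto simp: variable_words_def in_set_conv_nth)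
  show ?thesis
  proof (cases "w' ! c")
    case None
    then have eq: "u = u'" "v = v'" using ci[of c] cj[of c] c by auto
    obtain d where d: "d < length w" "w ! d \<noteq> w' ! d"
      using w(3,4) by (auto simp: list_eq_iff_nth_eq)
    show ?thesis
      using d ci[of d] cj[of d] A[of d] eq
      by (cases "w ! d"; cases "w' ! d") (auto simp: prod_eq_iff)
  qed (use c new in blast)
qed

lemma copies_overlap:
  assumes w: "w \<in> variable_words A" "w' \<in> variable_words A" "length w = length w'" "w \<noteq> w'"
    and ij: "i \<noteq> j"
    and i: "copy_map i j w (i, u) = copy_map i j w' (i, u')"
    and j: "copy_map i j w (j, v) = copy_map i j w' (j, v')"
  shows "(u, v) \<in> A" "(u', v') \<in> A"
  using copies_overlap_aux[OF w ij i j]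
    copies_overlap_aux[OF w(2,1) w(3,4)[symmetric] ij i[symmetric] j[symmetric]]
  by blast+

lemma simple_graph_amalgam:
  assumes "simple_graph P" "finite W" "W \<subseteq> variable_words A"
  shows "simple_graph (amalgam i j W P)"
proof -
  have "copy_map i j w ` e \<in> nsets (verts (amalgam i j W P)) 2" if we: "w \<in> W" "e \<in> edges P" for w e
  proof -
    have "inj (copy_map i j w)"
      using assms(3) we(1) by (intro inj_copy_map) (auto simp: variable_words_def)
    moreover have "e \<in> nsets (verts P) 2" using assms(1) we(2) by (auto simp: simple_graph_def)
    ultimately show ?thesis
      using we(1) by (auto simp: nsets_def amalgam_def card_image inj_on_subset[of _ UNIV])
  qed
  then show ?thesis
    using assms by (auto simp: simple_graph_def amalgam_def)
qed

lemma embedding_copy_map: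
  assumes "w \<in> W" "W \<subseteq> variable_words A"
  shows "embedding (copy_map i j w) P (amalgam i j W P)"
proof -
  have "inj (copy_map i j w)"
    using assms by (intro inj_copy_map) (auto simp: variable_words_def)
  then show ?thesis
    using assms(1) by (auto simp: embedding_def amalgam_def inj_on_subset[of _ UNIV])
qed

section \<open>Gluing colourings of transversal sets\<close>

text \<open>A transversal set has at most one vertex in each of the two levels, so at most two
  transpositions bring their colours to \<open>a\<close> and \<open>b\<close>, provided the equality
  patterns match. This makes the colourings of different copies agree on the levels they may
  share.\<close>

lemma recolour_levels:
  assumes X: "inj_on fst X" and c: "c ` X \<subseteq> {..<r}" and "a < r" "b < r" "i \<noteq> j"
    and ab: "\<And>x y. x \<in> X \<Longrightarrow> y \<in> X \<Longrightarrow> fst x = i \<Longrightarrow> fst y = j \<Longrightarrow> c x = c y \<longleftrightarrow> a = b"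
  shows "\<exists>\<pi> :: nat \<Rightarrow> nat. inj \<pi> \<and> \<pi> ` {..<r} \<subseteq> {..<r} \<and>
    (\<forall>x\<in>X. (fst x = i \<longrightarrow> \<pi> (c x) = a) \<and> (fst x = j \<longrightarrow> \<pi> (c x) = b))"
proof -
  have uniq: "x = y" if "x \<in> X" "y \<in> X" "fst x = fst y" for x y
    using X that by (auto dest: inj_onD)
  have tr: "transpose p q ` {..<r} \<subseteq> {..<r}" if "p < r" "q < r" for p q
    using that by (auto simp: transpose_def)
  consider x y where "x \<in> X" "y \<in> X" "fst x = i" "fst y = j"
    | x where "x \<in> X" "fst x = i" "\<forall>y\<in>X. fst y \<noteq> j"
    | y where "y \<in> X" "fst y = j" "\<forall>x\<in>X. fst x \<noteq> i"
    | "\<forall>x\<in>X. fst x \<noteq> i \<and> fst x \<noteq> j"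
    by blast
  then show ?thesis
  proof cases
    case (1 x y)
    have lt: "c x < r" "c y < r" using c 1 by auto
    \<comment> \<open>\<open>q\<close> is the colour of \<open>y\<close> after the first
      transposition. The second one sends \<open>q\<close> to \<open>b\<close> and keeps
      \<open>a\<close>, because either both \<open>q\<close> and \<open>b\<close> differ from
      \<open>a\<close> or all three coincide.\<close>
    define q where "q = transpose (c x) a (c y)"
    have "q < r" using lt assms(3) by (auto simp: q_def transpose_def)
    have iff: "c x = c y \<longleftrightarrow> a = b" using ab 1 by blast
    have qa: "q = a \<longleftrightarrow> c x = c y" by (auto simp: q_def transpose_def)
    define \<pi> where "\<pi> = transpose q b \<circ> transpose (c x) a"
    have pi: "\<pi> (c x) = a" "\<pi> (c y) = b"
      using iff qa by (auto simp: \<pi>_def q_def transpose_def)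
    have "inj \<pi>" unfolding \<pi>_def by (intro inj_compose) (auto simp: bij_is_inj)
    moreover have "\<pi> ` {..<r} \<subseteq> {..<r}"
      unfolding \<pi>_def image_comp[symmetric]
      using tr[OF lt(1) \<open>a < r\<close>] tr[OF \<open>q < r\<close> \<open>b < r\<close>] by blast
    ultimately show ?thesis
      using pi uniq 1 \<open>i \<noteq> j\<close> by (intro exI[of _ \<pi>]) metis
  next
    case (2 x)
    then have "c x < r" using c by auto
    have "transpose (c x) a (c y) = a" if "y \<in> X" "fst y = i" for y
      using uniq[OF that(1) 2(1)] that 2 by simp
    then show ?thesis
      using tr[OF \<open>c x < r\<close> \<open>a < r\<close>] 2(3)
      by (intro exI[of _ "transpose (c x) a"]) (simp add: bij_is_inj)
  next
    case (3 y)
    then have "c y < r" using c by auto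
    have "transpose (c y) b (c x) = b" if "x \<in> X" "fst x = j" for x
      using uniq[OF that(1) 3(1)] that 3 by simp
    then show ?thesis
      using tr[OF \<open>c y < r\<close> \<open>b < r\<close>] 3(3)
      by (intro exI[of _ "transpose (c y) b"]) (simp add: bij_is_inj)
  next
    case 4
    then show ?thesis by (intro exI[of _ id]) auto
  qed
qed

text \<open>Distinct copies share vertices in levels \<open>i\<close> and \<open>j\<close> only.
  Hence colourings of the traces of \<open>X\<close> on the copies can be glued once each of them
  uses the same colour \<open>a\<close> in level \<open>i\<close> and the same colour
  \<open>b\<close> in level \<open>j\<close>.\<close>

lemma colourable_on_amalgam:
  assumes P: "simple_graph P" and ij: "i \<noteq> j"
    and W: "W \<subseteq> variable_words (level_pairs i j P)" "\<And>w. w \<in> W \<Longrightarrow> length w = n"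
    and col: "\<And>X. X \<subseteq> verts P \<Longrightarrow> inj_on fst X \<Longrightarrow> colourable_on P r X"
    and X: "X \<subseteq> verts (amalgam i j W P)" "inj_on fst X"
  shows "colourable_on (amalgam i j W P) r X"
proof (cases "X = {}")
  case True
  then show ?thesis by (simp add: colourable_on_def)
next
  case False
  let ?q = "copy_map i j"
  \<comment> \<open>The trace of \<open>X\<close> on the copy of \<open>w\<close>, taken back to
    \<open>P\<close>. Copies preserve levels and are injective, so it is transversal like
    \<open>X\<close>.\<close>
  define H where "H w = {x \<in> verts P. ?q w x \<in> X}" for w
  have X_cover: "\<exists>w\<in>W. \<exists>x\<in>H w. y = ?q w x" if "y \<in> X" for y
    proof -
    have "verts (amalgam i j W P) = (\<Union>w\<in>W. ?q w ` verts P)" by (simp add: amalgam_def)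
    with X(1) that have "y \<in> (\<Union>w\<in>W. ?q w ` verts P)" by blast
    then obtain w x where "w \<in> W" "x \<in> verts P" "y = ?q w x" by blast
    then show ?thesis using that unfolding H_def by blast
  qed
  have inj_q: "inj (?q w)" if "w \<in> W" for w
    using W(1) that by (intro inj_copy_map) (auto simp: variable_words_def)
  have inj_H: "inj_on fst (H w)" if "w \<in> W" for w
  proof (rule inj_onI)
    fix x y assume xy: "x \<in> H w" "y \<in> H w" "fst x = fst y"
    have "?q w x = ?q w y" by (rule inj_onD[OF X(2)]) (use xy in \<open>simp_all add: H_def\<close>)
    then show "x = y" by (rule injD[OF inj_q[OF that]])
  qed
  have "\<forall>w\<in>W. colourable_on P r (H w)"
    using inj_H by (intro ballI col) (simp_all add: H_def subset_iff)
  then obtain c where c: "\<And>w. w \<in> W \<Longrightarrow> c w ` H w \<subseteq> {..<r}"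
    "\<And>w u v. w \<in> W \<Longrightarrow> u \<in> H w \<Longrightarrow> v \<in> H w \<Longrightarrow> {u, v} \<in> edges P \<Longrightarrow> c w u \<noteq> c w v"
    unfolding colourable_on_def by metis
  \<comment> \<open>This supplies default values for \<open>a\<close> and \<open>b\<close> when no
    single trace has vertices in both levels.\<close>
  have "r > 0"
  proof -
    obtain w x where "w \<in> W" "x \<in> H w" using False X_cover by blast
    then have "c w x < r" using c(1) by blast
    then show ?thesis by simp
  qed
  define both where "both w u v \<longleftrightarrow> w \<in> W \<and> (i, u) \<in> H w \<and> (j, v) \<in> H w" for w u v
  have "\<exists>a b. a < r \<and> b < r \<and> (\<forall>w u v. both w u v \<longrightarrow> (c w (i, u) = c w (j, v) \<longleftrightarrow> a = b))"
  proof (cases "\<exists>w u v. both w u v")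
    case False
    then show ?thesis using \<open>r > 0\<close> by blast
  next
    case True
    then obtain w0 u0 v0 where 0: "both w0 u0 v0" by blast
    have "c w (i, u) = c w (j, v) \<longleftrightarrow> c w0 (i, u0) = c w0 (j, v0)" if wuv: "both w u v" for w u v
    proof (cases "w = w0")
      case True
      then have "u = u0" "v = v0"
        using wuv 0 inj_onD[OF inj_H[of w0], of "(i, u)" "(i, u0)"]
          inj_onD[OF inj_H[of w0], of "(j, v)" "(j, v0)"]
        by (simp_all add: both_def)
      then show ?thesis using True by simp
    next
      case False
      have mem: "w \<in> W" "w0 \<in> W" "(i, u) \<in> H w" "(j, v) \<in> H w" "(i, u0) \<in> H w0" "(j, v0) \<in> H w0"
        using wuv 0 by (auto simp: both_def)
      \<comment> \<open>\<open>X\<close> has one vertex per level, so the two copies share both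
        vertices. By the overlap lemma these are adjacent in both copies, and each colouring gives
        them different colours.\<close>
      have "?q w (i, u) = ?q w0 (i, u0)" "?q w (j, v) = ?q w0 (j, v0)"
        by (rule inj_onD[OF X(2)]; use mem in \<open>simp add: H_def\<close>)+
      then have "(u, v) \<in> level_pairs i j P" "(u0, v0) \<in> level_pairs i j P"
        using copies_overlap[OF _ _ _ False ij, of "level_pairs i j P" u u0 v v0] W mem by auto
      then show ?thesis
        using c(2)[OF mem(1,3,4)] c(2)[OF mem(2,5,6)] by (simp add: level_pairs_def)
    qed
    moreover have "c w0 (i, u0) < r" "c w0 (j, v0) < r"
      using 0 c(1)[of w0] unfolding both_def by blast+
    ultimately show ?thesis by blast
  qed
  then obtain a b where ab: "a < r" "b < r"
    "\<And>w u v. both w u v \<Longrightarrow> (c w (i, u) = c w (j, v) \<longleftrightarrow> a = b)"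
    by blast
  have "\<exists>\<pi> :: nat \<Rightarrow> nat. inj \<pi> \<and> \<pi> ` {..<r} \<subseteq> {..<r} \<and>
    (\<forall>x\<in>H w. (fst x = i \<longrightarrow> \<pi> (c w x) = a) \<and> (fst x = j \<longrightarrow> \<pi> (c w x) = b))"
    if "w \<in> W" for w
  proof (rule recolour_levels)
    fix x y assume "x \<in> H w" "y \<in> H w" "fst x = i" "fst y = j"
    then show "c w x = c w y \<longleftrightarrow> a = b"
      using ab(3)[of w "snd x" "snd y"] that by (cases x; cases y) (simp add: both_def)
  qed (rule inj_H[OF that] c(1)[OF that] ab(1,2) ij)+
  then have "\<forall>w\<in>W. \<exists>\<pi> :: nat \<Rightarrow> nat. inj \<pi> \<and> \<pi> ` {..<r} \<subseteq> {..<r} \<and>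
    (\<forall>x\<in>H w. (fst x = i \<longrightarrow> \<pi> (c w x) = a) \<and> (fst x = j \<longrightarrow> \<pi> (c w x) = b))"
    by (rule ballI)
  from bchoice[OF this] obtain \<pi> where \<pi>: "\<forall>w\<in>W. inj (\<pi> w :: nat \<Rightarrow> nat) \<and>
    \<pi> w ` {..<r} \<subseteq> {..<r} \<and>
    (\<forall>x\<in>H w. (fst x = i \<longrightarrow> \<pi> w (c w x) = a) \<and> (fst x = j \<longrightarrow> \<pi> w (c w x) = b))"
    by (rule exE)
  have pi: "\<And>w. w \<in> W \<Longrightarrow> inj (\<pi> w)" "\<And>w. w \<in> W \<Longrightarrow> \<pi> w ` {..<r} \<subseteq> {..<r}"
    "\<And>w x. w \<in> W \<Longrightarrow> x \<in> H w \<Longrightarrow> fst x = i \<Longrightarrow> \<pi> w (c w x) = a"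
    "\<And>w x. w \<in> W \<Longrightarrow> x \<in> H w \<Longrightarrow> fst x = j \<Longrightarrow> \<pi> w (c w x) = b"
    using \<pi> by blast+
  define d where "d w x = \<pi> w (c w x)" for w x
  have agree: "d w x = d w' x'"
    if "w \<in> W" "x \<in> H w" "w' \<in> W" "x' \<in> H w'" "?q w x = ?q w' x'" for w x w' x'
  proof -
    have fst: "fst x' = fst x" using that(5) by (metis fst_copy_map)
    consider "fst x = i" | "fst x = j" | "fst x \<noteq> i" "fst x \<noteq> j" by blast
    then show ?thesis
    proof cases
      case 3
      then show ?thesis using copy_map_eq_outside[OF that(5)] by simp
    qed (simp_all add: d_def pi(3,4) that(1-4) fst)
  qed
  \<comment> \<open>By \<open>agree\<close>, the value does not depend on the copy chosen to
    represent \<open>y\<close>.\<close>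
  define C where "C y = (SOME k. \<exists>w\<in>W. \<exists>x\<in>H w. y = ?q w x \<and> k = d w x)" for y
  have C: "C (?q w x) = d w x" if "w \<in> W" "x \<in> H w" for w x
  proof -
    have "\<exists>k. \<exists>w'\<in>W. \<exists>x'\<in>H w'. ?q w x = ?q w' x' \<and> k = d w' x'"
      by (rule exI, rule bexI, rule bexI, rule conjI, rule refl, rule refl) (rule that)+
    from someI_ex[OF this, folded C_def]
    obtain w' x' where "w' \<in> W" "x' \<in> H w'" "?q w x = ?q w' x'" "C (?q w x) = d w' x'"
      by blast
    then show ?thesis using agree[OF that] by simp
  qed
  show ?thesis
    unfolding colourable_on_def
  proof (intro exI[of _ C] conjI ballI impI)
    show "C ` X \<subseteq> {..<r}"
    proof
      fix k assume "k \<in> C ` X"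
      then obtain w x where wx: "w \<in> W" "x \<in> H w" "k = d w x" using X_cover C by blast
      then show "k \<in> {..<r}" using c(1) pi(2) unfolding d_def by blast
    qed
  next
    fix y z assume yz: "y \<in> X" "z \<in> X" "{y, z} \<in> edges (amalgam i j W P)"
    then obtain w e where we: "w \<in> W" "e \<in> edges P" "{y, z} = ?q w ` e"
      by (auto simp: amalgam_def)
    obtain s t where st: "e = {s, t}" "s \<in> verts P" "t \<in> verts P"
      using P we(2) by (rule simple_graph_edgeE)
    have H: "s \<in> H w" "t \<in> H w" using we(3) st yz by (auto simp: H_def doubleton_eq_iff)
    then have "d w s \<noteq> d w t"
      using c(2)[OF we(1) H] we(2) st(1) pi(1)[OF we(1)] by (auto simp: d_def inj_eq)
    then have "C (?q w s) \<noteq> C (?q w t)" using C we(1) H by simp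
    then show "C y \<noteq> C z" using we(3) st(1) by (auto simp: doubleton_eq_iff)
  qed
qed

lemma finite_level_pairs:
  assumes P: "simple_graph P"
  shows "finite (level_pairs i j P)"
proof -
  have "level_pairs i j P \<subseteq> snd ` verts P \<times> snd ` verts P"
  proof (rule subrelI)
    fix u v assume "(u, v) \<in> level_pairs i j P"
    then have "{(i, u), (j, v)} \<in> edges P" by (simp add: level_pairs_def)
    from simple_graph_doubletonD(1,2)[OF P this] show "(u, v) \<in> snd ` verts P \<times> snd ` verts P"
      by (simp add: rev_image_eqI)
  qed
  then show ?thesis
    by (rule finite_subset) (use P in \<open>auto simp: simple_graph_def\<close>)
qed

text \<open>A word over the level pairs codes an edge: its first components form the end in level
  \<open>i\<close>, its second components the end in level \<open>j\<close>. The copy of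
  \<open>w\<close> sends the edge given by \<open>(u, v)\<close> to the edge coded by
  \<open>subst_word (u, v) w\<close>, so a monochromatic line makes all these edges of the copy
  monochromatic.\<close>

lemma amalgam_ramsey:
  assumes P: "simple_graph P" and ij: "i \<noteq> j"
  shows "\<exists>n. \<forall>f :: ('l \<times> nat) set \<Rightarrow> bool. \<exists>w\<in>variable_words (level_pairs i j P). length w = n \<and>
    (\<exists>b. \<forall>e\<in>edges P. fst ` e = {i, j} \<longrightarrow> f (copy_map i j w ` e) = b)"
proof -
  let ?A = "level_pairs i j P"
  from Hales_Jewett[OF finite_level_pairs[OF P]] obtain n where n: "\<forall>f :: (nat \<times> nat) list \<Rightarrow> bool.
    \<exists>w\<in>variable_words ?A. length w = n \<and> (\<exists>b. \<forall>a\<in>?A. f (subst_word a w) = b)"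
    by (rule exE)
  let ?code = "\<lambda>xs. to_nat (Inl xs :: nat list + (nat \<times> nat) option list \<times> nat)"
  show ?thesis
  proof (intro exI[of _ n] allI)
    fix f :: "('l \<times> nat) set \<Rightarrow> bool"
    obtain w b where w: "w \<in> variable_words ?A" "length w = n"
      and b: "\<And>a. a \<in> ?A \<Longrightarrow>
        f {(i, ?code (map fst (subst_word a w))), (j, ?code (map snd (subst_word a w)))} = b"
      using n[rule_format, of "\<lambda>x. f {(i, ?code (map fst x)), (j, ?code (map snd x))}"] by blast
    have mono: "f (copy_map i j w ` e) = b" if e: "e \<in> edges P" "fst ` e = {i, j}" for e
    proof -
      obtain x y where xy: "e = {x, y}" using P e(1) by (rule simple_graph_edgeE)
      then obtain u v where uv: "e = {(i, u), (j, v)}"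
        using e(2) ij by (cases x; cases y) (auto simp: doubleton_eq_iff)
      have fs: "fst (case s of None \<Rightarrow> (u, v) | Some a \<Rightarrow> id a) = case_option u fst s"
        "snd (case s of None \<Rightarrow> (u, v) | Some a \<Rightarrow> id a) = case_option v snd s" for s
        by (simp_all split: option.splits)
      have "copy_map i j w ` e =
        {(i, ?code (map fst (subst_word (u, v) w))), (j, ?code (map snd (subst_word (u, v) w)))}"
        using ij by (simp add: uv copy_map_def subst_word_def comp_def fs)
      moreover have "(u, v) \<in> ?A" using e(1) uv by (simp add: level_pairs_def)
      ultimately show ?thesis using b by metis
    qed
    show "\<exists>w\<in>variable_words ?A. length w = n \<and>
      (\<exists>b. \<forall>e\<in>edges P. fst ` e = {i, j} \<longrightarrow> f (copy_map i j w ` e) = b)"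
      by (rule bexI[OF _ w(1)], intro conjI w(2) exI[of _ b] ballI impI) (rule mono)
  qed
qed

section \<open>The partite construction\<close>

lemma embedding_comp:
  assumes "embedding p G F" "embedding q F K"
  shows "embedding (q \<circ> p) G K"
proof -
  have "inj_on (q \<circ> p) (verts G)"
    using assms by (auto simp: embedding_def intro!: comp_inj_on intro: inj_on_subset)
  moreover have "(q \<circ> p) ` e \<in> edges K" if "e \<in> edges G" for e
    using assms that unfolding embedding_def image_comp[symmetric] by blast
  moreover have "(q \<circ> p) ` verts G \<subseteq> verts K"
    using assms unfolding embedding_def image_comp[symmetric] by blast
  ultimately show ?thesis unfolding embedding_def by blast
qed

text \<open>The invariant of the partite construction: only sets meeting every level at most once
  have to be colourable.\<close>

definition transversally_colourable :: "('l \<times> nat) ugraph \<Rightarrow> nat \<Rightarrow> bool" where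
  "transversally_colourable P r \<longleftrightarrow> (\<forall>X \<subseteq> verts P. inj_on fst X \<longrightarrow> colourable_on P r X)"

definition level_embedding ::
  "('l \<times> nat \<Rightarrow> 'l \<times> nat) \<Rightarrow> ('l \<times> nat) ugraph \<Rightarrow> ('l \<times> nat) ugraph \<Rightarrow> bool" where
  "level_embedding q P0 P \<longleftrightarrow> embedding q P0 P \<and> (\<forall>x. fst (q x) = fst x)"

text \<open>The colour may vary with the level pair \<open>s\<close>. A colouring thus induces a
  colouring of the pairs in \<open>D\<close>, to which a Ramsey property of the underlying graph can
  be applied.\<close>

definition level_arrows ::
  "'l set set \<Rightarrow> ('l \<times> nat) ugraph \<Rightarrow> ('l \<times> nat) ugraph \<Rightarrow> bool" where
  "level_arrows D P P0 \<longleftrightarrow> (\<forall>f :: ('l \<times> nat) set \<Rightarrow> bool. \<exists>q. level_embedding q P0 P \<and>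
     (\<forall>s\<in>D. \<exists>b. \<forall>e\<in>edges P0. fst ` e = s \<longrightarrow> f (q ` e) = b))"

text \<open>One amalgamation for each pair in \<open>D\<close>. Hales-Jewett selects a copy of the
  previous stage that is monochromatic over the newest pair, and the induction hypothesis inside
  this copy takes care of the older pairs without disturbing the newest.\<close>

lemma partite_construction:
  fixes P0 :: "('l \<times> nat) ugraph"
  assumes P0: "simple_graph P0" "transversally_colourable P0 r"
    and "finite D" "\<And>s. s \<in> D \<Longrightarrow> card s = 2"
  shows "\<exists>P. simple_graph P \<and> transversally_colourable P r \<and>
    fst ` verts P \<subseteq> fst ` verts P0 \<and> (`) fst ` edges P \<subseteq> (`) fst ` edges P0 \<and>
    level_arrows D P P0"
  using assms(3,4)
proof (induction D)
  case empty
  have "level_embedding id P0 P0" by (simp add: level_embedding_def embedding_def)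
  then have "level_arrows {} P0 P0" by (auto simp: level_arrows_def)
  with P0 show ?case by blast
next
  case (insert s D)
  from insert.IH[OF insert.prems[OF insertI2]] obtain P where P: "simple_graph P"
    and col: "transversally_colourable P r"
    and sub: "fst ` verts P \<subseteq> fst ` verts P0" "(`) fst ` edges P \<subseteq> (`) fst ` edges P0"
    and ram: "level_arrows D P P0"
    by blast
  obtain i j where s: "s = {i, j}" and ij: "i \<noteq> j"
    using insert.prems[of s] by (auto simp: card_2_iff)
  let ?A = "level_pairs i j P"
  obtain n where n: "\<forall>f :: ('l \<times> nat) set \<Rightarrow> bool. \<exists>w\<in>variable_words ?A. length w = n \<and>
    (\<exists>b. \<forall>e\<in>edges P. fst ` e = {i, j} \<longrightarrow> f (copy_map i j w ` e) = b)"
    using amalgam_ramsey[OF P ij] by (rule exE)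
  define W where "W = {w \<in> variable_words ?A. length w = n}"
  have W: "W \<subseteq> variable_words ?A" "\<And>w. w \<in> W \<Longrightarrow> length w = n" by (auto simp: W_def)
  have "finite W"
  proof (rule finite_subset)
    show "W \<subseteq> {w. set w \<subseteq> insert None (Some ` ?A) \<and> length w = n}"
      by (auto simp: W_def variable_words_def)
    show "finite {w. set w \<subseteq> insert None (Some ` ?A) \<and> length w = n}"
      using finite_level_pairs[OF P] by (intro finite_lists_length_eq) simp
  qed
  let ?P = "amalgam i j W P"
  have "level_arrows (insert s D) ?P P0"
    unfolding level_arrows_def
  proof
    fix f :: "('l \<times> nat) set \<Rightarrow> bool"
    from n[rule_format, of f] obtain w where w: "w \<in> W"
      and "\<exists>b. \<forall>e\<in>edges P. fst ` e = {i, j} \<longrightarrow> f (copy_map i j w ` e) = b"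
      by (auto simp only: W_def)
    then obtain b where
      b: "\<forall>e\<in>edges P. fst ` e = {i, j} \<longrightarrow> f (copy_map i j w ` e) = b" by (elim exE)
    \<comment> \<open>The colouring is pulled back along the selected copy.\<close>
    from ram[unfolded level_arrows_def, rule_format, of "\<lambda>e. f (copy_map i j w ` e)"]
    obtain q where q: "level_embedding q P0 P"
      and D: "\<forall>s\<in>D. \<exists>b. \<forall>e\<in>edges P0. fst ` e = s \<longrightarrow> f (copy_map i j w ` q ` e) = b"
      by (elim exE conjE)
    let ?q = "copy_map i j w \<circ> q"
    have fst_q: "fst (q x) = fst x" for x using q unfolding level_embedding_def by blast
    have "embedding ?q P0 ?P"
      using q by (intro embedding_comp[OF _ embedding_copy_map[OF w W(1)]])
        (simp add: level_embedding_def)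
    then have emb: "level_embedding ?q P0 ?P" by (simp add: level_embedding_def fst_q)
    have new: "f (?q ` e) = b" if "e \<in> edges P0" "fst ` e = s" for e
    proof -
      have "q ` e \<in> edges P" using q that(1) by (simp add: level_embedding_def embedding_def)
      moreover have "fst ` q ` e = {i, j}" using that(2) s by (simp add: image_image fst_q)
      ultimately show ?thesis using b by (simp only: image_comp[symmetric])
    qed
    have old: "\<exists>b. \<forall>e\<in>edges P0. fst ` e = s' \<longrightarrow> f (?q ` e) = b" if "s' \<in> D" for s'
      using bspec[OF D that] by (simp only: image_comp[symmetric])
    show "\<exists>q. level_embedding q P0 ?P \<and>
        (\<forall>s\<in>insert s D. \<exists>b. \<forall>e\<in>edges P0. fst ` e = s \<longrightarrow> f (q ` e) = b)"
    proof (intro exI[of _ ?q] conjI emb ballI)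
      fix s' assume "s' \<in> insert s D"
      then consider "s' = s" | "s' \<in> D" by blast
      then show "\<exists>b. \<forall>e\<in>edges P0. fst ` e = s' \<longrightarrow> f (?q ` e) = b"
      proof cases
        case 1
        show ?thesis unfolding 1 by (intro exI[of _ b] ballI impI new)
      qed (rule old)
    qed
  qed
  moreover have "transversally_colourable ?P r"
    using col unfolding transversally_colourable_def
    by (intro allI impI colourable_on_amalgam[OF P ij W]) blast+
  moreover have "fst ` verts ?P \<subseteq> fst ` verts P"
    by (auto simp: amalgam_def image_UN image_image)
  from this sub(1) have "fst ` verts ?P \<subseteq> fst ` verts P0" by (rule order.trans)
  moreover have "(`) fst ` edges ?P \<subseteq> (`) fst ` edges P"
    by (auto simp: amalgam_def image_image)
  from this sub(2) have "(`) fst ` edges ?P \<subseteq> (`) fst ` edges P0" by (rule order.trans)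
  ultimately show ?case
    using simple_graph_amalgam[OF P \<open>finite W\<close> W(1)] by (intro exI[of _ ?P] conjI)
qed

section \<open>Locally colourable graphs that are Ramsey for a given graph\<close>

text \<open>The Ramsey property in terms of embeddings, which unlike isomorphic subgraphs can be
  composed directly.\<close>

definition arrows :: "'a ugraph \<Rightarrow> 'b ugraph \<Rightarrow> bool" where
  "arrows F G \<longleftrightarrow>
     (\<forall>f :: 'a set \<Rightarrow> bool. \<exists>g. embedding g G F \<and> (\<exists>b. \<forall>e\<in>edges G. f (g ` e) = b))"

definition locally_colourable :: "nat \<Rightarrow> 'a ugraph \<Rightarrow> nat \<Rightarrow> bool" where
  "locally_colourable s F r \<longleftrightarrow> (\<forall>X \<subseteq> verts F. card X \<le> s \<longrightarrow> colourable_on F r X)"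

lemma colourable_on_subset: "colourable_on F r Y \<Longrightarrow> X \<subseteq> Y \<Longrightarrow> colourable_on F r X"
  unfolding colourable_on_def by (erule ex_forward) blast

lemma colourable_on_hom:
  assumes "colourable_on F r (h ` X)"
    and "\<And>u v. u \<in> X \<Longrightarrow> v \<in> X \<Longrightarrow> {u, v} \<in> edges P \<Longrightarrow> {h u, h v} \<in> edges F"
  shows "colourable_on P r X"
proof -
  obtain c where "c ` h ` X \<subseteq> {..<r}"
    and "\<forall>u\<in>h ` X. \<forall>v\<in>h ` X. {u, v} \<in> edges F \<longrightarrow> c u \<noteq> c v"
    using assms(1) unfolding colourable_on_def by blast
  then show ?thesis
    unfolding colourable_on_def using assms(2) by (intro exI[of _ "c \<circ> h"]) (auto simp: image_comp)
qed

text \<open>In the copy for the embedding \<open>g\<close>, the vertex \<open>x\<close> gets level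
  \<open>g x\<close> and a number coding \<open>(g, x)\<close>. The numbers keep the copies
  disjoint, so each vertex determines its original in \<open>G\<close>; this homomorphism to
  \<open>G\<close> pulls back the colouring.\<close>

lemma disjoint_copies:
  fixes G :: "'a ugraph" and F :: "'l ugraph"
  assumes G: "simple_graph G" "proper_colouring G r c" and F: "simple_graph F"
  shows "\<exists>P0 :: ('l \<times> nat) ugraph. simple_graph P0 \<and> colourable_on P0 r (verts P0) \<and>
    fst ` verts P0 \<subseteq> verts F \<and> (`) fst ` edges P0 \<subseteq> edges F \<and>
    (\<forall>g. embedding g G F \<longrightarrow> (\<exists>p. embedding p G P0 \<and> (\<forall>x\<in>verts G. fst (p x) = g x)))"
proof -
  \<comment> \<open>Extensional functions make the set of embeddings finite; an arbitrary
    \<open>g\<close> is represented by its restriction to \<open>verts G\<close>.\<close>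
  define S where "S = {g \<in> verts G \<rightarrow>\<^sub>E verts F. embedding g G F}"
  have "finite (verts G \<rightarrow>\<^sub>E verts F)"
    using G F by (intro finite_PiE) (auto simp: simple_graph_def)
  then have "finite S" unfolding S_def by simp
  then have "finite (S \<times> verts G)" using G by (simp add: simple_graph_def)
  from finite_imp_inj_to_nat_seg[OF this]
  obtain k :: "('a \<Rightarrow> 'l) \<times> 'a \<Rightarrow> nat" where k: "inj_on k (S \<times> verts G)"
    by (elim exE conjE)
  define p where "p g x = (g x, k (g, x))" for g x
  define P0 where "P0 = \<lparr>verts = (\<Union>g\<in>S. p g ` verts G), edges = (\<Union>g\<in>S. (`) (p g) ` edges G)\<rparr>"
  have inj: "g = g' \<and> x = x'" if "g \<in> S" "g' \<in> S" "x \<in> verts G" "x' \<in> verts G" "p g x = p g' x'"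
    for g g' x x'
  proof -
    have "k (g, x) = k (g', x')" using that(5) by (simp add: p_def)
    then have "(g, x) = (g', x')" by (rule inj_onD[OF k]) (simp_all add: that)
    then show ?thesis by simp
  qed
  have emb: "embedding (p g) G P0" if "g \<in> S" for g
    unfolding embedding_def
  proof (intro conjI ballI)
    show "inj_on (p g) (verts G)" by (intro inj_onI) (use inj[OF that that] in blast)
  qed (use that in \<open>auto simp: P0_def\<close>)
  have edge: "e \<in> nsets (verts P0) 2" if e: "e \<in> edges P0" for e
  proof -
    obtain g e' where g: "g \<in> S" "e' \<in> edges G" "e = p g ` e'" using e by (auto simp: P0_def)
    have "e' \<in> nsets (verts G) 2" using G(1) g(2) by (auto simp: simple_graph_def)
    then have "finite e'" "card e' = 2" "e' \<subseteq> verts G" by (auto simp: nsets_def)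
    moreover have "inj_on (p g) e'"
      using emb[OF g(1)] \<open>e' \<subseteq> verts G\<close> by (auto simp: embedding_def intro: inj_on_subset)
    ultimately show ?thesis
      using g emb[OF g(1)] by (auto simp: nsets_def card_image embedding_def)
  qed
  have simple: "simple_graph P0"
    using G(1) edge \<open>finite S\<close> by (auto simp: simple_graph_def P0_def)
  have "\<forall>y\<in>verts P0. \<exists>x. x \<in> verts G \<and> (\<exists>g\<in>S. y = p g x)" unfolding P0_def by auto
  from bchoice[OF this] obtain h where
    h: "\<forall>y\<in>verts P0. h y \<in> verts G \<and> (\<exists>g\<in>S. y = p g (h y))" by (rule exE)
  have hp: "h (p g x) = x" if "g \<in> S" "x \<in> verts G" for g x
  proof -
    have "p g x \<in> verts P0" using that by (auto simp: P0_def)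
    with h obtain g' where g': "g' \<in> S" "h (p g x) \<in> verts G" "p g x = p g' (h (p g x))" by blast
    from inj[OF that(1) g'(1) that(2) g'(2,3)] show ?thesis by (elim conjE) (rule sym)
  qed
  have "colourable_on P0 r (verts P0)"
  proof (rule colourable_on_hom)
    show "colourable_on G r (h ` verts P0)"
      using G(2) h by (auto simp: proper_colouring_def colourable_on_def intro!: exI[of _ c])
    fix u v assume uv: "{u, v} \<in> edges P0"
    then obtain g e where ge: "g \<in> S" "e \<in> edges G" "{u, v} = p g ` e" by (auto simp: P0_def)
    obtain s t where st: "e = {s, t}" "s \<in> verts G" "t \<in> verts G"
      using G(1) ge(2) by (rule simple_graph_edgeE)
    have "{h u, h v} = h ` {u, v}" by simp
    also have "\<dots> = {s, t}" using ge(3) st hp[OF ge(1)] by simp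
    finally show "{h u, h v} \<in> edges G" using ge(2) st by simp
  qed
  moreover have "fst ` verts P0 \<subseteq> verts F"
    by (auto simp: P0_def p_def S_def embedding_def)
  moreover have "(`) fst ` edges P0 \<subseteq> edges F"
    by (auto simp: P0_def p_def S_def embedding_def image_image)
  moreover have "\<exists>p. embedding p G P0 \<and> (\<forall>x\<in>verts G. fst (p x) = g x)" if g: "embedding g G F" for g
  proof -
    let ?g = "restrict g (verts G)"
    have "?g ` e = g ` e" if "e \<in> edges G" for e
      using simple_graph_edge_subset[OF G(1) that] by (intro image_cong) auto
    then have "?g \<in> S"
      using g by (auto simp: S_def embedding_def inj_on_def)
    from emb[OF this] show ?thesis by (intro exI[of _ "p ?g"]) (simp add: p_def)
  qed
  ultimately show ?thesis using simple by (intro exI[of _ P0] conjI allI impI)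
qed

text \<open>Ramsey's theorem gives a monochromatic clique on \<open>card (verts G)\<close> vertices,
  and any bijection from \<open>verts G\<close> onto it is an embedding.\<close>

lemma complete_graph_arrows:
  assumes G: "simple_graph G"
  shows "\<exists>N. arrows \<lparr>verts = {..<N::nat}, edges = nsets {..<N} 2\<rparr> G"
proof -
  let ?m = "card (verts G)"
  obtain N :: nat where N: "partn_lst {..<N} [?m, ?m] 2" using ramsey_full by blast
  let ?K = "\<lparr>verts = {..<N}, edges = nsets {..<N} 2\<rparr>"
  have "arrows ?K G"
    unfolding arrows_def
  proof
    fix f :: "nat set \<Rightarrow> bool"
    have "(\<lambda>e. if f e then 1 else 0) \<in> nsets {..<N} 2 \<rightarrow> {..<2::nat}" by simp
    with N obtain i :: nat and M where i: "i < length [?m, ?m]" and M: "M \<in> nsets {..<N} ([?m, ?m] ! i)"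
      and mono: "(\<lambda>e. if f e then 1 else 0) ` nsets M 2 \<subseteq> {i}"
      by (rule partn_lstE) simp_all
    have "[?m, ?m] ! i = ?m" using i by (cases i) auto
    with M have M': "M \<subseteq> {..<N}" "card M = ?m" "finite M" by (auto simp: nsets_def)
    obtain g where g: "bij_betw g (verts G) M"
      using finite_same_card_bij[of "verts G" M] M' G by (auto simp: simple_graph_def)
    have e: "g ` e \<in> nsets M 2" if "e \<in> edges G" for e
    proof -
      have "e \<in> nsets (verts G) 2" using G that by (auto simp: simple_graph_def)
      then have "e \<subseteq> verts G" "finite e" "card e = 2" by (simp_all add: nsets_def)
      moreover have "inj_on g e"
        using g \<open>e \<subseteq> verts G\<close> by (meson bij_betw_imp_inj_on inj_on_subset)
      moreover have "g ` e \<subseteq> M" using g \<open>e \<subseteq> verts G\<close> by (auto simp: bij_betw_def)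
      ultimately show ?thesis by (simp add: nsets_def card_image)
    qed
    have "embedding g G ?K"
      using g M' e nsets_mono[OF M'(1), of 2] by (auto simp: embedding_def bij_betw_def)
    moreover have "f (g ` e) = (i = 1)" if "e \<in> edges G" for e
    proof -
      have "(if f (g ` e) then 1 else 0) = i" using mono e[OF that] by blast
      then show ?thesis by (simp split: if_splits)
    qed
    ultimately show "\<exists>g. embedding g G ?K \<and> (\<exists>b. \<forall>e\<in>edges G. f (g ` e) = b)"
      by (intro exI[of _ g] conjI exI[of _ "i = 1"] ballI)
  qed
  then show ?thesis by (rule exI)
qed


lemma sparse_ramsey_step:
  fixes G :: "'a ugraph" and F :: "nat ugraph"
  assumes G: "simple_graph G" "proper_colouring G r c"
    and F: "simple_graph F" "arrows F G" "locally_colourable s F r"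
  shows "\<exists>F' :: nat ugraph. simple_graph F' \<and> arrows F' G \<and> locally_colourable (Suc s) F' r"
proof -
  from disjoint_copies[OF G F(1)] obtain P0 :: "(nat \<times> nat) ugraph" where P0: "simple_graph P0"
    and col0: "colourable_on P0 r (verts P0)"
    and sub0: "fst ` verts P0 \<subseteq> verts F" "(`) fst ` edges P0 \<subseteq> edges F"
    and copy: "\<forall>g. embedding g G F \<longrightarrow>
      (\<exists>p. embedding p G P0 \<and> (\<forall>x\<in>verts G. fst (p x) = g x))"
    by (elim exE conjE)
  have "transversally_colourable P0 r"
    using colourable_on_subset[OF col0] by (simp add: transversally_colourable_def)
  moreover have "card e = 2" if "e \<in> edges F" for e
    using F(1) that by (auto simp: simple_graph_def nsets_def)
  ultimately obtain P where P: "simple_graph P" "transversally_colourable P r"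
    and sub: "fst ` verts P \<subseteq> fst ` verts P0" "(`) fst ` edges P \<subseteq> (`) fst ` edges P0"
    and ram: "level_arrows (edges F) P P0"
    using partite_construction[OF P0 _ simple_graph_finite_edges[OF F(1)], of r]
    by (elim meta_impE exE conjE)
  have subF: "fst ` verts P \<subseteq> verts F" "(`) fst ` edges P \<subseteq> edges F"
    by (rule order.trans[OF sub(1) sub0(1)], rule order.trans[OF sub(2) sub0(2)])
  \<comment> \<open>Encoding the pairs returns to vertices of type \<open>nat\<close>, so that the
    step can be iterated.\<close>
  define F' where "F' = \<lparr>verts = prod_encode ` verts P, edges = (`) prod_encode ` edges P\<rparr>"
  have inj: "inj_on prod_encode A" for A by (rule inj_prod_encode)
  have emb: "embedding prod_encode P F'"
    using inj by (auto simp: embedding_def F'_def)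
  have "prod_encode ` e \<in> nsets (verts F') 2" if "e \<in> edges P" for e
  proof -
    have "e \<in> nsets (verts P) 2" using P(1) that by (auto simp: simple_graph_def)
    then show ?thesis by (auto simp: nsets_def F'_def card_image[OF inj])
  qed
  then have simple: "simple_graph F'" using P(1) by (auto simp: simple_graph_def F'_def)
  have arr: "arrows F' G"
    unfolding arrows_def
  proof
    fix f :: "nat set \<Rightarrow> bool"
    from ram[unfolded level_arrows_def, rule_format, of "\<lambda>e. f (prod_encode ` e)"]
    obtain q where q: "level_embedding q P0 P"
      and "\<forall>s\<in>edges F. \<exists>b. \<forall>e\<in>edges P0. fst ` e = s \<longrightarrow> f (prod_encode ` q ` e) = b"
      by (elim exE conjE)
    \<comment> \<open>In the chosen copy of \<open>P0\<close> the colour of an edge depends only on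
      its projection. This gives the colouring \<open>h\<close> of \<open>F\<close>; over a copy of
      \<open>G\<close> that is monochromatic for \<open>h\<close> lies a copy in \<open>P0\<close>
      whose image is monochromatic for \<open>f\<close>.\<close>
    from bchoice[OF this(2)] obtain h where
      h: "\<forall>s\<in>edges F. \<forall>e\<in>edges P0. fst ` e = s \<longrightarrow> f (prod_encode ` q ` e) = h s"
      by (rule exE)
    from F(2)[unfolded arrows_def, rule_format, of h] obtain g b where g: "embedding g G F"
      and b: "\<forall>e\<in>edges G. h (g ` e) = b" by (elim exE conjE)
    from copy[rule_format, OF g] obtain p where p: "embedding p G P0"
      and fst_p: "\<forall>x\<in>verts G. fst (p x) = g x" by (elim exE conjE)
    let ?g = "prod_encode \<circ> (q \<circ> p)"
    have "embedding ?g G F'"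
      by (rule embedding_comp[OF embedding_comp[OF p conjunct1] emb])
        (rule q[unfolded level_embedding_def])
    moreover have "f (?g ` e) = b" if e: "e \<in> edges G" for e
    proof -
      have "p ` e \<in> edges P0" "g ` e \<in> edges F" using p g e by (simp_all add: embedding_def)
      moreover have "fst ` p ` e = g ` e"
        unfolding image_image using fst_p simple_graph_edge_subset[OF G(1) e]
        by (intro image_cong) auto
      ultimately have "f (prod_encode ` q ` p ` e) = h (g ` e)" using h by simp
      then show ?thesis using b e by (simp only: image_comp[symmetric])
    qed
    ultimately show "\<exists>g. embedding g G F' \<and> (\<exists>b. \<forall>e\<in>edges G. f (g ` e) = b)"
      by (intro exI[of _ ?g] conjI exI[of _ b] ballI)
  qed
  have "locally_colourable (Suc s) F' r"
    unfolding locally_colourable_def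
  proof (intro allI impI)
    fix X assume X: "X \<subseteq> verts F'" "card X \<le> Suc s"
    define Y where "Y = prod_decode ` X"
    have XY: "X = prod_encode ` Y" by (simp add: Y_def image_image)
    have Y: "Y \<subseteq> verts P" using X(1) by (auto simp: Y_def F'_def)
    then have "finite Y" using P(1) finite_subset by (auto simp: simple_graph_def)
    have "colourable_on P r Y"
    proof (cases "inj_on fst Y")
      case True
      then show ?thesis using P(2) Y by (simp add: transversally_colourable_def)
    next
      case False
      \<comment> \<open>Without injectivity the projection loses a vertex, so the local
        colourability of \<open>F\<close> applies to it and the colouring can be pulled
        back.\<close>
      have "card (fst ` Y) < card Y"
        using card_image_le[OF \<open>finite Y\<close>, of fst] False
          inj_on_iff_eq_card[OF \<open>finite Y\<close>, of fst] by linarith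
      also have "card Y \<le> Suc s" using X(2) unfolding XY by (simp add: card_image[OF inj])
      finally have "card (fst ` Y) \<le> s" by simp
      moreover have "fst ` Y \<subseteq> verts F" using Y subF(1) by blast
      ultimately have "colourable_on F r (fst ` Y)" using F(3) by (simp add: locally_colourable_def)
      then show ?thesis
      proof (rule colourable_on_hom)
        fix u v assume "{u, v} \<in> edges P"
        then have "fst ` {u, v} \<in> edges F" using subF(2) by blast
        then show "{fst u, fst v} \<in> edges F" by simp
      qed
    qed
    then have "colourable_on P r (prod_decode ` X)" by (simp only: Y_def)
    then show "colourable_on F' r X"
    proof (rule colourable_on_hom)
      fix u v assume "{u, v} \<in> edges F'"
      then obtain e where e: "e \<in> edges P" "{u, v} = prod_encode ` e" by (auto simp: F'_def)
      have "{prod_decode u, prod_decode v} = prod_decode ` {u, v}" by simp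
      also have "\<dots> = e" unfolding e(2) by (simp add: image_image)
      finally show "{prod_decode u, prod_decode v} \<in> edges P" using e(1) by simp
    qed
  qed
  with simple arr show ?thesis by (intro exI conjI)
qed

lemma sparse_ramsey:
  fixes G :: "'a ugraph"
  assumes G: "simple_graph G" "proper_colouring G r c"
  shows "\<exists>F :: nat ugraph. simple_graph F \<and> arrows F G \<and> locally_colourable s F r"
proof (induction s)
  case 0
  obtain N where N: "arrows \<lparr>verts = {..<N::nat}, edges = nsets {..<N} 2\<rparr> G" (is "arrows ?K G")
    using complete_graph_arrows[OF G(1)] by (rule exE)
  \<comment> \<open>For \<open>s = 0\<close> only the empty set has to be coloured, so a complete
    graph will do.\<close>
  have "X = {}" if "X \<subseteq> verts ?K" "card X \<le> 0" for X :: "nat set"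
    using that finite_subset[of X "{..<N}"] by simp
  then have "locally_colourable 0 ?K r"
    by (auto simp: locally_colourable_def colourable_on_def)
  moreover have "simple_graph ?K" by (simp add: simple_graph_def)
  ultimately show ?case using N by (intro exI conjI)
next
  case (Suc s)
  then show ?case using sparse_ramsey_step[OF G] by blast
qed

section \<open>Passing to monochromatic subgraphs and the chromatic number\<close>

lemma arrows_imp_is_ramsey_for:
  assumes G: "simple_graph G" and F: "arrows F G"
  shows "is_ramsey_for F G"
  unfolding is_ramsey_for_def
proof
  fix f :: "'b set \<Rightarrow> bool"
  from F[unfolded arrows_def, rule_format, of f] obtain g b where g: "embedding g G F"
    and b: "\<forall>e\<in>edges G. f (g ` e) = b" by (elim exE conjE)
  have inj: "inj_on g (verts G)" using g by (simp add: embedding_def)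
  define S where "S = \<lparr>verts = g ` verts G, edges = (`) g ` edges G\<rparr>"
  have "g ` e \<in> nsets (g ` verts G) 2" if "e \<in> edges G" for e
  proof -
    have e: "e \<in> nsets (verts G) 2" using G that by (auto simp: simple_graph_def)
    then have "inj_on g e" using inj by (auto simp: nsets_def intro: inj_on_subset)
    with e show ?thesis by (auto simp: nsets_def card_image)
  qed
  then have "simple_graph S" using G by (auto simp: simple_graph_def S_def)
  then have "subgraph S F" using g by (auto simp: subgraph_def S_def embedding_def)
  moreover have "graph_iso S G"
    unfolding graph_iso_def
  \<comment> \<open>The isomorphism runs from the image back to \<open>G\<close>, hence the inverse
    of \<open>g\<close>. Edges are reflected because \<open>g\<close> is injective on all of
    \<open>verts G\<close>.\<close>
  proof (intro exI[of _ "the_inv_into (verts G) g"] conjI ballI)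
    show "bij_betw (the_inv_into (verts G) g) (verts S) (verts G)"
      using inj by (simp add: S_def bij_betw_the_inv_into bij_betw_def inj_on_the_inv_into)
    fix u v assume "u \<in> verts S" "v \<in> verts S"
    then obtain x y where xy: "u = g x" "v = g y" "x \<in> verts G" "y \<in> verts G" by (auto simp: S_def)
    have "{g x, g y} \<in> (`) g ` edges G \<longleftrightarrow> {x, y} \<in> edges G"
    proof
      assume "{g x, g y} \<in> (`) g ` edges G"
      then obtain e where e: "e \<in> edges G" "g ` e = g ` {x, y}" by auto
      have "e = {x, y}"
        using inj_on_image_eq_iff[OF inj simple_graph_edge_subset[OF G e(1)], of "{x, y}"]
          e(2) xy by auto
      with e(1) show "{x, y} \<in> edges G" by simp
    next
      assume "{x, y} \<in> edges G"
      then show "{g x, g y} \<in> (`) g ` edges G" by (rule rev_image_eqI) simp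
    qed
    then show "{u, v} \<in> edges S \<longleftrightarrow>
        {the_inv_into (verts G) g u, the_inv_into (verts G) g v} \<in> edges G"
      using xy inj by (simp add: S_def the_inv_into_f_f)
  qed
  moreover have "\<forall>e\<in>edges S. f e = b" using b by (simp add: S_def)
  ultimately show "\<exists>S. subgraph S F \<and> graph_iso S G \<and> (\<exists>b. \<forall>e\<in>edges S. f e = b)"
    by (intro exI conjI)
qed

text \<open>A copy of \<open>H\<close> in \<open>F\<close> has \<open>card (verts H)\<close>
  vertices, so local colourability covers it, and its colouring is carried over to
  \<open>H\<close>.\<close>

lemma subgraph_iso_chromatic_number_le:
  assumes H: "simple_graph H" and F: "locally_colourable (card (verts H)) F r"
    and S: "subgraph S F" "graph_iso S H"
  shows "chromatic_number H \<le> r"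
proof -
  obtain h where h: "bij_betw h (verts S) (verts H)"
    and edge: "\<forall>u\<in>verts S. \<forall>v\<in>verts S. {u, v} \<in> edges S \<longleftrightarrow> {h u, h v} \<in> edges H"
    using S(2) unfolding graph_iso_def by (elim exE conjE)
  let ?k = "the_inv_into (verts S) h"
  have k: "?k v \<in> verts S" "h (?k v) = v" if "v \<in> verts H" for v
    using h that by (auto simp: bij_betw_def f_the_inv_into_f intro: the_inv_into_into)
  have "card (verts S) = card (verts H)" using h by (rule bij_betw_same_card)
  then have "colourable_on F r (verts S)"
    using F S(1) by (simp add: locally_colourable_def subgraph_def)
  then obtain c where c: "c ` verts S \<subseteq> {..<r}"
    "\<forall>u\<in>verts S. \<forall>v\<in>verts S. {u, v} \<in> edges F \<longrightarrow> c u \<noteq> c v"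
    unfolding colourable_on_def by (elim exE conjE)
  have "proper_colouring H r (c \<circ> ?k)"
    unfolding proper_colouring_def
  proof (intro conjI allI impI)
    show "(c \<circ> ?k) ` verts H \<subseteq> {..<r}" using c(1) k(1) by auto
    fix u v assume uv: "{u, v} \<in> edges H"
    then have "u \<in> verts H" "v \<in> verts H" using simple_graph_doubletonD[OF H] by auto
    then have "{?k u, ?k v} \<in> edges F" "?k u \<in> verts S" "?k v \<in> verts S"
      using uv edge k S(1) by (auto simp: subgraph_def)
    then show "(c \<circ> ?k) u \<noteq> (c \<circ> ?k) v" using c(2) by simp
  qed
  then show ?thesis unfolding chromatic_number_def by (intro Least_le exI)
qed

theorem theorem1:
  fixes G :: "'a ugraph" and H :: "'b ugraph"
  assumes "simple_graph G" and "simple_graph H"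
    and "chromatic_number G < chromatic_number H"
  shows "\<exists>F :: nat ugraph. simple_graph F \<and> is_ramsey_for F G \<and> \<not> is_ramsey_for F H"
proof -
  obtain c where "proper_colouring G (chromatic_number G) c"
    using chromatic_number_attained[OF assms(1)] by (rule exE)
  from sparse_ramsey[OF assms(1) this, of "card (verts H)"]
  obtain F :: "nat ugraph" where F: "simple_graph F" "arrows F G"
    and loc: "locally_colourable (card (verts H)) F (chromatic_number G)" by (elim exE conjE)
  \<comment> \<open>\<open>F\<close> has no subgraph isomorphic to \<open>H\<close>, so any
    colouring of its edges shows that it is not Ramsey for \<open>H\<close>.\<close>
  have "\<not> subgraph S F \<or> \<not> graph_iso S H" for S
    using subgraph_iso_chromatic_number_le[OF assms(2) loc] assms(3) by force
  then have "\<not> is_ramsey_for F H" by (auto simp: is_ramsey_for_def)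
  with F(1) arrows_imp_is_ramsey_for[OF assms(1) F(2)] show ?thesis by (intro exI conjI)
qed

end
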